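(* Let $n,m\ge 1$, let $C_0,\dots,C_m$ and $C'_0,\dots,C'_m$ be $n$-qubit Clifford gates, and let $k_1,\dots,k_m,l_1,\dots,l_m\in\{1,\dots,n\}$. Let $F,F':\mathcal U_2^m\to\mathcal U_{2^n}$ be the associated circuit functions and $B,B'$ their decision matrices (all defined in the context). Then $F$ and $F'$ are equivalent for all assignments, i.e. there exists $\phi\in\mathbb R$ such that $$F'(\vec U)=e^{i\phi}F(\vec U)\quad\text{for all }\vec U\in\mathcal U_2^m,$$ if and only if the following two conditions hold simultaneously: $B'=B$, and there exists $\phi\in\mathbb R$ with $C'_{m:0}=e^{i\phi}C_{m:0}$.
   Context: $\mathcal U_d$ denotes the set of $d\times d$ unitary matrices, and $\mathcal P=\{I,X,Y,Z\}\subset\mathcal U_2$ the set of single-qubit Pauli matrices. For a $2\times 2$ matrix $A$ and $1\le k\le n$, $A^{(k)}:=I^{\otimes(k-1)}\otimes A\otimes I^{\otimes(n-k)}$. An $n$-qubit Clifford gate is a unitary $C\in\mathcal U_{2^n}$ such that for every Pauli string $Q=Q_1\otimes\cdots\otimes Q_n$ ($Q_q\in\mathcal P$), $CQC^\dagger$ is $\pm$ a Pauli string. For $\vec U=(U_1,\dots,U_m)$, $$F(\vec U)=C_mU_m^{(k_m)}C_{m-1}U_{m-1}^{(k_{m-1})}\cdots C_1U_1^{(k_1)}C_0,\qquad F'(\vec U)=C'_mU_m^{(l_m)}C'_{m-1}U_{m-1}^{(l_{m-1})}\cdots C'_1U_1^{(l_1)}C'_0 .$$ For $a\ge b$, $C_{a:b}:=C_aC_{a-1}\cdots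 C_b$ and $C'_{a:b}:=C'_aC'_{a-1}\cdots C'_b$. For $1\le i\le m$ and $P\in\mathcal P$, $$V_i(P):=C_{m:i}P^{(k_i)}C_{m:i}^\dagger,\qquad V'_i(P):=C'_{m:i}P^{(l_i)}C_{m:i}'^{\dagger}.$$ Each of these operators is of the form $(-1)^{r}Q_1\otimes\cdots\otimes Q_n$ with $r\in\{0,1\}$, $Q_q\in\mathcal P$. The binary symplectic representation of such an operator is the vector $(z_1,\dots,z_n,x_1,\dots,x_n,r)^\top\in\mathbb F_2^{2n+1}$, where $(z_q,x_q)=(0,0),(0,1),(1,1),(1,0)$ according as $Q_q=I,X,Y,Z$. Let $\bm v_i(P)$, $\bm v'_i(P)$ be the binary symplectic representations of $V_i(P)$, $V'_i(P)$. The decision matrix of $F$ is the $(2n+1)\times 2m$ matrix over $\mathbb F_2$ $$B=[\,\bm v_1(Z),\dots,\bm v_m(Z)\mid \bm v_1(X),\dots,\bm v_m(X)\,],$$ and $B'$ is defined in the same way from the $\bm v'_i$. *)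

theory Defs
  imports "Jordan_Normal_Form.Schur_Decomposition" "HOL-Library.Z2"
begin

definition unitaries :: "nat \<Rightarrow> complex mat set" where
  "unitaries d = {A \<in> carrier_mat d d. A * mat_adjoint A = 1\<^sub>m d \<and> mat_adjoint A * A = 1\<^sub>m d}"

definition kron :: "complex mat \<Rightarrow> complex mat \<Rightarrow> complex mat" (infixr "\<otimes>\<^sub>K" 71) where
  "A \<otimes>\<^sub>K B = mat (dim_row A * dim_row B) (dim_col A * dim_col B)
     (\<lambda>(i, j). A $$ (i div dim_row B, j div dim_col B) * B $$ (i mod dim_row B, j mod dim_col B))"

definition tensor_list :: "complex mat list \<Rightarrow> complex mat" where
  "tensor_list As = foldr kron As (1\<^sub>m 1)"

definition on_qubit :: "nat \<Rightarrow> nat \<Rightarrow> complex mat \<Rightarrow> complex mat" where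
  "on_qubit n k A = tensor_list (replicate (k - 1) (1\<^sub>m 2) @ [A] @ replicate (n - k) (1\<^sub>m 2))"

datatype pauli = PauliI | PauliX | PauliY | PauliZ

primrec pauli_mat :: "pauli \<Rightarrow> complex mat" where
  "pauli_mat PauliI = 1\<^sub>m 2"
| "pauli_mat PauliX = mat_of_rows_list 2 [[0, 1], [1, 0]]"
| "pauli_mat PauliY = mat_of_rows_list 2 [[0, - \<i>], [\<i>, 0]]"
| "pauli_mat PauliZ = mat_of_rows_list 2 [[1, 0], [0, - 1]]"

definition pauli_string :: "pauli list \<Rightarrow> complex mat" where
  "pauli_string Qs = tensor_list (map pauli_mat Qs)"

text \<open>\<open>signed_pauli r [Q\<^sub>1, \<dots>, Q\<^sub>n]\<close> is the operator $(-1)^r Q_1 \otimes \dots \otimes Q_n$.\<close>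

definition signed_pauli :: "bit \<Rightarrow> pauli list \<Rightarrow> complex mat" where
  "signed_pauli r Qs = (if r = 1 then - 1 else 1) \<cdot>\<^sub>m pauli_string Qs"

definition clifford :: "nat \<Rightarrow> complex mat \<Rightarrow> bool" where
  "clifford n C \<longleftrightarrow> C \<in> unitaries (2 ^ n) \<and>
     (\<forall>Qs. length Qs = n \<longrightarrow>
        (\<exists>r Rs. length Rs = n \<and> C * pauli_string Qs * mat_adjoint C = signed_pauli r Rs))"

text \<open>\<open>gate_prod n C a b\<close> is $C_a C_{a-1} \cdots C_b$, for $a \ge b$.\<close>

definition gate_prod :: "nat \<Rightarrow> (nat \<Rightarrow> complex mat) \<Rightarrow> nat \<Rightarrow> nat \<Rightarrow> complex mat" where
  "gate_prod n C a b = foldr (*) (map C (rev [b..<Suc a])) (1\<^sub>m (2 ^ n))"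

text \<open>\<open>circuit n C k m U\<close> is $C_m U_m^{(k_m)} C_{m-1} U_{m-1}^{(k_{m-1})} \cdots C_1 U_1^{(k_1)} C_0$;
  qubits and the gates \<open>U i\<close> are numbered from 1.\<close>

primrec circuit ::
  "nat \<Rightarrow> (nat \<Rightarrow> complex mat) \<Rightarrow> (nat \<Rightarrow> nat) \<Rightarrow> nat \<Rightarrow> (nat \<Rightarrow> complex mat) \<Rightarrow> complex mat"
where
  "circuit n C k 0 U = C 0"
| "circuit n C k (Suc i) U = C (Suc i) * on_qubit n (k (Suc i)) (U (Suc i)) * circuit n C k i U"

definition conj_pauli ::
  "nat \<Rightarrow> nat \<Rightarrow> (nat \<Rightarrow> complex mat) \<Rightarrow> (nat \<Rightarrow> nat) \<Rightarrow> nat \<Rightarrow> pauli \<Rightarrow> complex mat"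
where
  "conj_pauli n m C k i P =
     gate_prod n C m i * on_qubit n (k i) (pauli_mat P) * mat_adjoint (gate_prod n C m i)"

primrec z_bit :: "pauli \<Rightarrow> bit" where
  "z_bit PauliI = 0" | "z_bit PauliX = 0" | "z_bit PauliY = 1" | "z_bit PauliZ = 1"

primrec x_bit :: "pauli \<Rightarrow> bit" where
  "x_bit PauliI = 0" | "x_bit PauliX = 1" | "x_bit PauliY = 1" | "x_bit PauliZ = 0"

definition symplectic_vec :: "bit \<Rightarrow> pauli list \<Rightarrow> bit vec" where
  "symplectic_vec r Qs = vec_of_list (map z_bit Qs @ map x_bit Qs @ [r])"

text \<open>The representation of an operator; it is well defined on signed \<open>n\<close>-qubit Pauli strings
  by the lemma \<open>symplectic_rep_signed_pauli\<close> below.\<close>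

definition symplectic_rep :: "nat \<Rightarrow> complex mat \<Rightarrow> bit vec" where
  "symplectic_rep n A =
     (THE v. \<exists>r Qs. length Qs = n \<and> A = signed_pauli r Qs \<and> v = symplectic_vec r Qs)"

definition decision_matrix ::
  "nat \<Rightarrow> nat \<Rightarrow> (nat \<Rightarrow> complex mat) \<Rightarrow> (nat \<Rightarrow> nat) \<Rightarrow> bit mat"
where
  "decision_matrix n m C k = mat_of_cols (2 * n + 1)
     (map (\<lambda>i. symplectic_rep n (conj_pauli n m C k i PauliZ)) [1..<Suc m] @
      map (\<lambda>i. symplectic_rep n (conj_pauli n m C k i PauliX)) [1..<Suc m])"

lemma kron_dim [simp]:
  "dim_row (A \<otimes>\<^sub>K B) = dim_row A * dim_row B" "dim_col (A \<otimes>\<^sub>K B) = dim_col A * dim_col B"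
  by (simp_all add: kron_def)

lemma pauli_mat_dim [simp]: "dim_row (pauli_mat P) = 2" "dim_col (pauli_mat P) = 2"
  by (cases P; simp add: mat_of_rows_list_def)+

lemma pauli_string_simps [simp]:
  "pauli_string [] = 1\<^sub>m 1" "pauli_string (Q # Qs) = pauli_mat Q \<otimes>\<^sub>K pauli_string Qs"
  by (simp_all add: pauli_string_def tensor_list_def)

lemma pauli_string_dim [simp]:
  "dim_row (pauli_string Qs) = 2 ^ length Qs" "dim_col (pauli_string Qs) = 2 ^ length Qs"
  by (induction Qs) simp_all

lemma block_index_less:
  assumes "a < p" "i < q"
  shows "a * q + i < p * (q::nat)"
proof -
  have "a * q + i < Suc a * q" using assms(2) by simp
  also have "\<dots> \<le> p * q" using assms(1) by (intro mult_le_mono1) simp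
  finally show ?thesis .
qed

lemma pauli_mat_row0_nonzero: "\<exists>b < 2. pauli_mat Q $$ (0, b) \<noteq> 0"
proof (cases "Q = PauliI \<or> Q = PauliZ")
  case True
  then show ?thesis by (intro exI[of _ 0]) (auto simp: mat_of_rows_list_def)
next
  case False
  then show ?thesis by (intro exI[of _ 1], cases Q) (auto simp: mat_of_rows_list_def)
qed

lemma kron_block:
  assumes "a < dim_row A" "b < dim_col A" "i < dim_row B" "j < dim_col B"
  shows "(A \<otimes>\<^sub>K B) $$ (a * dim_row B + i, b * dim_col B + j) = A $$ (a, b) * B $$ (i, j)"
proof -
  have "a * dim_row B + i < dim_row A * dim_row B"
    using assms by (simp add: block_index_less)
  moreover have "b * dim_col B + j < dim_col A * dim_col B"
    using assms by (simp add: block_index_less)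
  ultimately show ?thesis using assms by (simp add: kron_def)
qed

lemma pauli_string_nonzero:
  "\<exists>i < 2 ^ length Qs. \<exists>j < 2 ^ length Qs. pauli_string Qs $$ (i, j) \<noteq> 0"
proof (induction Qs)
  case Nil
  show ?case by simp
next
  case (Cons Q Qs)
  then obtain i j where ij: "i < 2 ^ length Qs" "j < 2 ^ length Qs" "pauli_string Qs $$ (i, j) \<noteq> 0"
    by blast
  obtain b where b: "b < 2" "pauli_mat Q $$ (0, b) \<noteq> 0" using pauli_mat_row0_nonzero by blast
  have "pauli_string (Q # Qs) $$ (0 * 2 ^ length Qs + i, b * 2 ^ length Qs + j) \<noteq> 0"
    using kron_block[of 0 "pauli_mat Q" b i "pauli_string Qs" j] ij b by simp
  moreover have "b * 2 ^ length Qs + j < 2 ^ length (Q # Qs)"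
    using block_index_less[OF b(1) ij(2)] by simp
  moreover have "0 * 2 ^ length Qs + i < (2::nat) ^ length (Q # Qs)" using ij by simp
  ultimately show ?case by blast
qed

lemma smult_pauli_string_inject:
  assumes "length Qs = length Rs" "s \<in> {1, - 1 :: complex}" "t \<in> {1, - 1}"
    and "\<And>i j. i < 2 ^ length Qs \<Longrightarrow> j < 2 ^ length Qs \<Longrightarrow>
           s * pauli_string Qs $$ (i, j) = t * pauli_string Rs $$ (i, j)"
  shows "s = t \<and> Qs = Rs"
  using assms
proof (induction Qs Rs arbitrary: s t rule: list_induct2)
  case Nil
  then show ?case by simp
next
  case (Cons Q Qs R Rs)
  let ?N = "2 ^ length Qs :: nat"
  have blk: "s * (pauli_mat Q $$ (a, b) * pauli_string Qs $$ (i, j))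
      = t * (pauli_mat R $$ (a, b) * pauli_string Rs $$ (i, j))"
    if "a < 2" "b < 2" "i < ?N" "j < ?N" for a b i j
  proof -
    have "a * ?N + i < 2 ^ length (Q # Qs)" "b * ?N + j < 2 ^ length (Q # Qs)"
      using block_index_less[OF that(1,3)] block_index_less[OF that(2,4)] by simp_all
    from Cons.prems(3)[OF this] show ?thesis
      using kron_block[of a "pauli_mat Q" b i "pauli_string Qs" j]
        kron_block[of a "pauli_mat R" b i "pauli_string Rs" j] that Cons.hyps by simp
  qed
  obtain i j where ij: "i < ?N" "j < ?N" "pauli_string Qs $$ (i, j) \<noteq> 0"
    using pauli_string_nonzero by blast
  note b4 = blk[of 0 0 i j] blk[of 0 1 i j] blk[of 1 0 i j] blk[of 1 1 i j]
  have QR: "Q = R"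
    using b4 ij Cons.prems(1,2)
    by (cases Q; cases R) (auto simp: mat_of_rows_list_def)
  obtain b where b: "b < 2" "pauli_mat R $$ (0, b) \<noteq> 0" using pauli_mat_row0_nonzero by blast
  have "s * pauli_string Qs $$ (i, j) = t * pauli_string Rs $$ (i, j)"
    if "i < ?N" "j < ?N" for i j
    using blk[of 0 b i j] that b QR by (simp add: mult.left_commute)
  from Cons.IH[OF Cons.prems(1,2) this] QR show ?case by simp
qed

lemma signed_pauli_inject:
  assumes "length Qs = length Rs" "signed_pauli r Qs = signed_pauli s Rs"
  shows "r = s \<and> Qs = Rs"
proof -
  let ?\<sigma> = "\<lambda>r::bit. if r = 1 then - 1 else (1::complex)"
  have "?\<sigma> r * pauli_string Qs $$ (i, j) = ?\<sigma> s * pauli_string Rs $$ (i, j)"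
    if "i < 2 ^ length Qs" "j < 2 ^ length Qs" for i j
    using arg_cong[OF assms(2), of "\<lambda>A. A $$ (i, j)"] that assms(1)
    by (simp add: signed_pauli_def)
  from smult_pauli_string_inject[OF assms(1) _ _ this]
  have "?\<sigma> r = ?\<sigma> s \<and> Qs = Rs" by auto
  then show ?thesis by (cases r; cases s) auto
qed

lemma symplectic_rep_signed_pauli:
  assumes "length Qs = n"
  shows "symplectic_rep n (signed_pauli r Qs) = symplectic_vec r Qs"
  unfolding symplectic_rep_def
  using assms signed_pauli_inject by (intro the_equality) (blast, metis)

end

theory Submission
  imports Defs
begin

text \<open>Moving all Clifford gates to the right writes the circuit as
  $W_m(U_m) \cdots W_1(U_1) \, C_{m:0}$ with $W_i(A) = C_{m:i} A^{(k_i)} C_{m:i}^\dagger$.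
  Each $W_i$ is a unital algebra homomorphism, so it is determined by $W_i(X) = V_i(X)$ and
  $W_i(Z) = V_i(Z)$, that is, by two columns of the decision matrix. Conversely, setting all
  \<open>U\<^sub>j\<close> to the identity recovers $C_{m:0}$ up to the phase, and then letting a single \<open>U\<^sub>i\<close> vary
  recovers $W_i$ exactly, because the phase is the same for all assignments.\<close>

text \<open>Reassociation to the right is the normal form for many later matrix identities. The
  dimension \<open>d\<close> occurs only in the carrier premises, so uses instantiate it, and the
  first part then discharges these premises for nested products.\<close>

lemma square_mult_simps:
  fixes A B C :: "'a::semiring_0 mat"
  assumes "A \<in> carrier_mat d d" "B \<in> carrier_mat d d"
  shows "A * B \<in> carrier_mat d d" "C \<in> carrier_mat d d \<Longrightarrow> A * B * C = A * (B * C)"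
  using assms by (simp_all add: assoc_mult_mat[of _ d d _ d _ d] mult_carrier_mat[of _ d d _ d])

section \<open>Adjoints and unitary matrices\<close>

lemma carrier_unitaries: "A \<in> unitaries d \<Longrightarrow> A \<in> carrier_mat d d"
  by (simp add: unitaries_def)

lemma dim_mat_adjoint [simp]:
  "dim_row (mat_adjoint A) = dim_col A" "dim_col (mat_adjoint A) = dim_row A"
  by (simp_all add: mat_adjoint_def)

lemma carrier_mat_adjoint [simp]: "A \<in> carrier_mat p q \<Longrightarrow> mat_adjoint A \<in> carrier_mat q p"
  by (intro carrier_matI) auto

lemma index_mat_adjoint [simp]:
  fixes A :: "complex mat"
  assumes "i < dim_col A" "j < dim_row A"
  shows "mat_adjoint A $$ (i, j) = cnj (A $$ (j, i))"
  using assms by (simp add: mat_adjoint_def mat_of_rows_index)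

lemma mat_adjoint_mult:
  fixes A B :: "complex mat"
  assumes "A \<in> carrier_mat p q" "B \<in> carrier_mat q r"
  shows "mat_adjoint (A * B) = mat_adjoint B * mat_adjoint A"
  by (rule eq_matI) (use assms in \<open>auto simp: scalar_prod_def mult.commute intro!: sum.cong\<close>)

lemma mat_adjoint_one: "mat_adjoint (1\<^sub>m d :: complex mat) = 1\<^sub>m d"
  by (rule eq_matI) auto

lemma one_unitaries: "1\<^sub>m d \<in> unitaries d"
  by (simp add: unitaries_def mat_adjoint_one)

lemma mult_unitaries:
  assumes "A \<in> unitaries d" "B \<in> unitaries d"
  shows "A * B \<in> unitaries d"
proof -
  have c: "A \<in> carrier_mat d d" "B \<in> carrier_mat d d" using assms by (auto simp: unitaries_def)
  have "A * B * (mat_adjoint B * mat_adjoint A) = A * (B * mat_adjoint B) * mat_adjoint A"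
    using c by (simp add: square_mult_simps[of _ d])
  moreover have "mat_adjoint B * mat_adjoint A * (A * B) = mat_adjoint B * (mat_adjoint A * A) * B"
    using c by (simp add: square_mult_simps[of _ d])
  ultimately show ?thesis
    using assms c by (simp add: unitaries_def mat_adjoint_mult[OF c])
qed

lemma pauli_mat_unitaries: "pauli_mat P \<in> unitaries 2"
proof -
  have "pauli_mat P * mat_adjoint (pauli_mat P) = 1\<^sub>m 2 \<and>
      mat_adjoint (pauli_mat P) * pauli_mat P = 1\<^sub>m 2"
    by (intro conjI eq_matI; cases P)
      (auto simp: scalar_prod_def mat_of_rows_list_def numeral_2_eq_2 less_Suc_eq)
  then show ?thesis by (auto simp: unitaries_def intro: carrier_matI)
qed

section \<open>Kronecker products\<close>

lemma sum_div_mod: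
  fixes f :: "nat \<Rightarrow> nat \<Rightarrow> 'a::comm_monoid_add"
  shows "(\<Sum>k<p * q. f (k div q) (k mod q)) = (\<Sum>x<p. \<Sum>y<q. f x y)"
proof -
  have "(\<Sum>k<p * q. f (k div q) (k mod q)) = (\<Sum>(x, y)\<in>{..<p} \<times> {..<q}. f x y)"
    by (rule sum.reindex_bij_witness[of _ "\<lambda>(x, y). x * q + y" "\<lambda>k. (k div q, k mod q)"])
      (auto simp: less_mult_imp_div_less block_index_less intro!: mod_less_divisor gr0I)
  then show ?thesis by (simp add: sum.cartesian_product)
qed

lemma div_mod_less:
  fixes i :: nat
  assumes "i < p * q"
  shows "i div q < p" "i mod q < q"
  using assms by (auto simp: less_mult_imp_div_less intro!: mod_less_divisor gr0I)

lemma kron_add_left: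
  assumes "A \<in> carrier_mat p q" "B \<in> carrier_mat p q"
  shows "(A + B) \<otimes>\<^sub>K C = A \<otimes>\<^sub>K C + B \<otimes>\<^sub>K C"
  by (rule eq_matI) (use assms in \<open>auto simp: kron_def div_mod_less distrib_right\<close>)

lemma kron_add_right:
  assumes "B \<in> carrier_mat p q" "C \<in> carrier_mat p q"
  shows "A \<otimes>\<^sub>K (B + C) = A \<otimes>\<^sub>K B + A \<otimes>\<^sub>K C"
  by (rule eq_matI) (use assms in \<open>auto simp: kron_def div_mod_less distrib_left\<close>)

lemma kron_smult_left: "(c \<cdot>\<^sub>m A) \<otimes>\<^sub>K B = c \<cdot>\<^sub>m (A \<otimes>\<^sub>K B)"
  by (rule eq_matI) (auto simp: kron_def div_mod_less)

lemma kron_smult_right: "A \<otimes>\<^sub>K (c \<cdot>\<^sub>m B) = c \<cdot>\<^sub>m (A \<otimes>\<^sub>K B)"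
  by (rule eq_matI) (auto simp: kron_def div_mod_less)

lemma kron_one: "1\<^sub>m p \<otimes>\<^sub>K 1\<^sub>m q = 1\<^sub>m (p * q)"
proof (rule eq_matI)
  fix i j assume "i < dim_row (1\<^sub>m (p * q))" "j < dim_col (1\<^sub>m (p * q))"
  moreover have "i = j \<longleftrightarrow> i div q = j div q \<and> i mod q = j mod q"
    by (metis div_mult_mod_eq)
  ultimately show "(1\<^sub>m p \<otimes>\<^sub>K 1\<^sub>m q) $$ (i, j) = 1\<^sub>m (p * q) $$ (i, j)"
    by (auto simp: kron_def div_mod_less)
qed auto

text \<open>The mixed-product rule: a summation index below \<open>b * q\<close> splits into a
  quotient below \<open>b\<close> and a remainder below \<open>q\<close>, so the sum for one entry
  on the right factors into the two sums on the left.\<close>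

lemma kron_mult:
  assumes A: "A \<in> carrier_mat a b" and C: "C \<in> carrier_mat b c"
    and B: "B \<in> carrier_mat p q" and D: "D \<in> carrier_mat q r"
  shows "(A * C) \<otimes>\<^sub>K (B * D) = (A \<otimes>\<^sub>K B) * (C \<otimes>\<^sub>K D)"
proof (rule eq_matI)
  fix i j assume "i < dim_row ((A \<otimes>\<^sub>K B) * (C \<otimes>\<^sub>K D))" "j < dim_col ((A \<otimes>\<^sub>K B) * (C \<otimes>\<^sub>K D))"
  then have i: "i < a * p" and j: "j < c * r" using assms by auto
  note lt = div_mod_less[OF i] div_mod_less[OF j]
  have "((A * C) \<otimes>\<^sub>K (B * D)) $$ (i, j) =
      (\<Sum>x<b. A $$ (i div p, x) * C $$ (x, j div r)) * (\<Sum>y<q. B $$ (i mod p, y) * D $$ (y, j mod r))"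
    using assms i j lt by (simp add: kron_def scalar_prod_def atLeast0LessThan)
  also have "\<dots> = (\<Sum>x<b. \<Sum>y<q. A $$ (i div p, x) * B $$ (i mod p, y) *
      (C $$ (x, j div r) * D $$ (y, j mod r)))"
    by (simp add: sum_product mult_ac)
  also have "\<dots> = (\<Sum>k<b * q. A $$ (i div p, k div q) * B $$ (i mod p, k mod q) *
      (C $$ (k div q, j div r) * D $$ (k mod q, j mod r)))"
    by (rule sum_div_mod[symmetric])
  also have "\<dots> = ((A \<otimes>\<^sub>K B) * (C \<otimes>\<^sub>K D)) $$ (i, j)"
    using assms i j by (simp add: kron_def scalar_prod_def atLeast0LessThan)
  finally show "((A * C) \<otimes>\<^sub>K (B * D)) $$ (i, j) = ((A \<otimes>\<^sub>K B) * (C \<otimes>\<^sub>K D)) $$ (i, j)" .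
qed (use assms in auto)

section \<open>Gates acting on one qubit\<close>

lemma tensor_list_simps [simp]:
  "tensor_list [] = 1\<^sub>m 1" "tensor_list (A # As) = A \<otimes>\<^sub>K tensor_list As"
  by (simp_all add: tensor_list_def)

lemma tensor_list_replicate_one: "tensor_list (replicate q (1\<^sub>m 2)) = 1\<^sub>m (2 ^ q)"
  by (induction q) (simp_all add: kron_one)

text \<open>Free \<open>p\<close> and \<open>q\<close> in place of \<open>k - 1\<close> and
  \<open>n - k\<close> allow induction on the prefix. The fact supplies the dimensions whenever a
  Kronecker rule is applied to a tail of the tensor product.\<close>

lemma kron_one_prefix_carrier:
  assumes "A \<in> carrier_mat 2 2"
  shows "tensor_list (replicate p (1\<^sub>m 2) @ A # replicate q (1\<^sub>m 2)) \<in>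
    carrier_mat (2 ^ (p + Suc q)) (2 ^ (p + Suc q))"
  by (induction p) (use assms in \<open>auto simp: tensor_list_replicate_one intro!: carrier_matI\<close>)

lemma on_qubit_carrier:
  assumes "A \<in> carrier_mat 2 2" "k \<in> {1..n}"
  shows "on_qubit n k A \<in> carrier_mat (2 ^ n) (2 ^ n)"
proof -
  have "k - 1 + Suc (n - k) = n" using assms(2) by auto
  with kron_one_prefix_carrier[OF assms(1), of "k - 1" "n - k"] show ?thesis
    by (simp add: on_qubit_def)
qed

lemma on_qubit_one:
  assumes "k \<in> {1..n}"
  shows "on_qubit n k (1\<^sub>m 2) = 1\<^sub>m (2 ^ n)"
proof -
  have n: "k - 1 + Suc (n - k) = n" using assms by auto
  have "replicate (k - 1) x @ [x] @ replicate (n - k) x = replicate (k - 1 + Suc (n - k)) x"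
    for x :: "complex mat"
    by (simp only: replicate_add replicate_Suc append_Cons append_Nil)
  then show ?thesis by (simp only: on_qubit_def tensor_list_replicate_one n)
qed

lemma on_qubit_smult: "on_qubit n k (c \<cdot>\<^sub>m A) = c \<cdot>\<^sub>m on_qubit n k A"
proof -
  have "tensor_list (replicate p (1\<^sub>m 2) @ [c \<cdot>\<^sub>m A] @ R) =
      c \<cdot>\<^sub>m tensor_list (replicate p (1\<^sub>m 2) @ [A] @ R)" for p R
    by (induction p) (simp_all add: kron_smult_left kron_smult_right)
  then show ?thesis by (simp only: on_qubit_def)
qed

lemma on_qubit_add:
  assumes "A \<in> carrier_mat 2 2" "B \<in> carrier_mat 2 2"
  shows "on_qubit n k (A + B) = on_qubit n k A + on_qubit n k B"
proof -
  have "tensor_list (replicate p (1\<^sub>m 2) @ (A + B) # replicate q (1\<^sub>m 2)) =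
      tensor_list (replicate p (1\<^sub>m 2) @ A # replicate q (1\<^sub>m 2)) +
      tensor_list (replicate p (1\<^sub>m 2) @ B # replicate q (1\<^sub>m 2))" for p q
    by (induction p) (simp_all add: kron_add_left[OF assms]
        kron_add_right[OF kron_one_prefix_carrier[OF assms(1)] kron_one_prefix_carrier[OF assms(2)]])
  then show ?thesis by (simp only: on_qubit_def append_Cons append_Nil)
qed

lemma on_qubit_mult:
  assumes "A \<in> carrier_mat 2 2" "B \<in> carrier_mat 2 2"
  shows "on_qubit n k (A * B) = on_qubit n k A * on_qubit n k B"
proof -
  have "tensor_list (replicate p (1\<^sub>m 2) @ (A * B) # replicate q (1\<^sub>m 2)) =
      tensor_list (replicate p (1\<^sub>m 2) @ A # replicate q (1\<^sub>m 2)) *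
      tensor_list (replicate p (1\<^sub>m 2) @ B # replicate q (1\<^sub>m 2))" for p q
  \<comment> \<open>The mixed-product rule is used with identities as second factors in the base
    case (the tail) and as first factors in the step (the leading qubit).\<close>
  proof (induction p)
    case 0
    show ?case
      using kron_mult[OF assms one_carrier_mat one_carrier_mat, of "2 ^ q"]
      by (simp add: tensor_list_replicate_one)
  next
    case (Suc p)
    show ?case
      using kron_mult[OF one_carrier_mat one_carrier_mat kron_one_prefix_carrier[OF assms(1)]
          kron_one_prefix_carrier[OF assms(2)], of 2 p q] Suc by simp
  qed
  then show ?thesis by (simp only: on_qubit_def append_Cons append_Nil)
qed

text \<open>Brings a single-qubit Pauli gate into the form that the Clifford condition speaks
  about.\<close>

lemma on_qubit_pauli_mat:
  "on_qubit n k (pauli_mat P) =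
     pauli_string (replicate (k - 1) PauliI @ [P] @ replicate (n - k) PauliI)"
  by (simp add: on_qubit_def pauli_string_def)

text \<open>With \<open>G\<close> the product C_m ... C_i and \<open>k\<close> the qubit k_i, this
  is the map W_i of the overview. Unlike \<open>conj_pauli\<close> it takes any matrix, so it covers
  the gates \<open>U i\<close> and linear combinations.\<close>

definition conj_on_qubit :: "nat \<Rightarrow> complex mat \<Rightarrow> nat \<Rightarrow> complex mat \<Rightarrow> complex mat" where
  "conj_on_qubit n G k A = G * on_qubit n k A * mat_adjoint G"

lemma conj_pauli_eq_conj_on_qubit:
  "conj_pauli n m C k i P = conj_on_qubit n (gate_prod n C m i) (k i) (pauli_mat P)"
  by (simp add: conj_pauli_def conj_on_qubit_def)

section \<open>Conjugation as a unital algebra homomorphism\<close>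

context
  fixes n k :: nat and G :: "complex mat"
  assumes G: "G \<in> unitaries (2 ^ n)" and k: "k \<in> {1..n}"
begin

lemma conj_on_qubit_carrier:
  "A \<in> carrier_mat 2 2 \<Longrightarrow> conj_on_qubit n G k A \<in> carrier_mat (2 ^ n) (2 ^ n)"
  using carrier_unitaries[OF G] on_qubit_carrier[OF _ k]
  by (simp add: conj_on_qubit_def square_mult_simps[of _ "2^n"])

lemma conj_on_qubit_one: "conj_on_qubit n G k (1\<^sub>m 2) = 1\<^sub>m (2 ^ n)"
  using G k
  by (simp add: conj_on_qubit_def on_qubit_one unitaries_def right_mult_one_mat[of _ "2^n" "2^n"])

lemma conj_on_qubit_smult:
  assumes "A \<in> carrier_mat 2 2"
  shows "conj_on_qubit n G k (c \<cdot>\<^sub>m A) = c \<cdot>\<^sub>m conj_on_qubit n G k A"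
  using carrier_unitaries[OF G] on_qubit_carrier[OF assms k]
  by (simp add: conj_on_qubit_def on_qubit_smult mult_smult_distrib[of _ "2^n" "2^n" _ "2^n"]
      mult_smult_assoc_mat[of _ "2^n" "2^n" _ "2^n"])

lemma conj_on_qubit_add:
  assumes "A \<in> carrier_mat 2 2" "B \<in> carrier_mat 2 2"
  shows "conj_on_qubit n G k (A + B) = conj_on_qubit n G k A + conj_on_qubit n G k B"
  using carrier_unitaries[OF G] on_qubit_carrier[OF assms(1) k] on_qubit_carrier[OF assms(2) k]
  by (simp add: conj_on_qubit_def on_qubit_add[OF assms] mult_add_distrib_mat[of _ "2^n" "2^n" _ "2^n"]
      add_mult_distrib_mat[of _ "2^n" "2^n" _ _ "2^n"])

text \<open>The factor \<open>mat_adjoint G * G\<close> cancels at the right end. By this rule a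
  gate passes from the right of \<open>G\<close> to its left.\<close>

lemma conj_on_qubit_commute:
  assumes "A \<in> carrier_mat 2 2"
  shows "conj_on_qubit n G k A * G = G * on_qubit n k A"
proof -
  note c = carrier_unitaries[OF G] on_qubit_carrier[OF assms k]
  have "conj_on_qubit n G k A * G = G * (on_qubit n k A * (mat_adjoint G * G))"
    using c by (simp add: conj_on_qubit_def square_mult_simps[of _ "2^n"])
  then show ?thesis using G c by (simp add: unitaries_def)
qed

lemma conj_on_qubit_mult:
  assumes "A \<in> carrier_mat 2 2" "B \<in> carrier_mat 2 2"
  shows "conj_on_qubit n G k (A * B) = conj_on_qubit n G k A * conj_on_qubit n G k B"
proof -
  note c = carrier_unitaries[OF G] on_qubit_carrier[OF assms(1) k] on_qubit_carrier[OF assms(2) k]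
    conj_on_qubit_carrier[OF assms(1)]
  have "conj_on_qubit n G k A * conj_on_qubit n G k B =
      (conj_on_qubit n G k A * G) * (on_qubit n k B * mat_adjoint G)"
    \<comment> \<open>Only the second factor is unfolded: its leading \<open>G\<close> is what the
      commutation rule needs next to the first factor.\<close>
    using c unfolding conj_on_qubit_def[of n G k B]
    by (simp add: square_mult_simps[of _ "2^n"])
  also have "\<dots> = conj_on_qubit n G k (A * B)"
    using c unfolding conj_on_qubit_commute[OF assms(1)]
    by (simp add: conj_on_qubit_def on_qubit_mult[OF assms] square_mult_simps[of _ "2^n"])
  finally show ?thesis by simp
qed

end

text \<open>Since XZ = -iY, this is the expansion in the Pauli basis up to a scalar. Writing XZ
  instead of Y lets a multiplicative map be evaluated from its values at X and Z alone.\<close>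

lemma mat_2_2_decomposition:
  fixes A :: "complex mat"
  assumes "A \<in> carrier_mat 2 2"
  obtains a b c d where
    "A = a \<cdot>\<^sub>m 1\<^sub>m 2 + b \<cdot>\<^sub>m pauli_mat PauliX + c \<cdot>\<^sub>m pauli_mat PauliZ
       + d \<cdot>\<^sub>m (pauli_mat PauliX * pauli_mat PauliZ)"
proof
  show "A = ((A $$ (0,0) + A $$ (1,1)) / 2) \<cdot>\<^sub>m 1\<^sub>m 2
      + ((A $$ (0,1) + A $$ (1,0)) / 2) \<cdot>\<^sub>m pauli_mat PauliX
      + ((A $$ (0,0) - A $$ (1,1)) / 2) \<cdot>\<^sub>m pauli_mat PauliZ
      + ((A $$ (1,0) - A $$ (0,1)) / 2) \<cdot>\<^sub>m (pauli_mat PauliX * pauli_mat PauliZ)"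
    by (rule eq_matI)
      (use assms in \<open>auto simp: scalar_prod_def mat_of_rows_list_def numeral_2_eq_2 less_Suc_eq field_simps\<close>)
qed

text \<open>X and Z generate the algebra of 2 by 2 matrices, and both sides are unital algebra
  homomorphisms in \<open>A\<close>.\<close>

lemma conj_on_qubit_cong:
  assumes G: "G \<in> unitaries (2 ^ n)" "G' \<in> unitaries (2 ^ n)" and k: "k \<in> {1..n}" "l \<in> {1..n}"
    and X: "conj_on_qubit n G' l (pauli_mat PauliX) = conj_on_qubit n G k (pauli_mat PauliX)"
    and Z: "conj_on_qubit n G' l (pauli_mat PauliZ) = conj_on_qubit n G k (pauli_mat PauliZ)"
    and A: "A \<in> carrier_mat 2 2"
  shows "conj_on_qubit n G' l A = conj_on_qubit n G k A"
proof -
  have c: "pauli_mat P \<in> carrier_mat 2 2" for P by (rule carrier_matI) simp_all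
  obtain \<alpha> \<beta> \<gamma> \<delta> where A: "A = \<alpha> \<cdot>\<^sub>m 1\<^sub>m 2 + \<beta> \<cdot>\<^sub>m pauli_mat PauliX + \<gamma> \<cdot>\<^sub>m pauli_mat PauliZ
       + \<delta> \<cdot>\<^sub>m (pauli_mat PauliX * pauli_mat PauliZ)"
    using mat_2_2_decomposition[OF A] .
  \<comment> \<open>Stated for generic \<open>H\<close> and \<open>j\<close> so that it expands both
    sides; the result depends on them only through the images of X and Z.\<close>
  have "conj_on_qubit n H j A = \<alpha> \<cdot>\<^sub>m 1\<^sub>m (2 ^ n) + \<beta> \<cdot>\<^sub>m conj_on_qubit n H j (pauli_mat PauliX)
      + \<gamma> \<cdot>\<^sub>m conj_on_qubit n H j (pauli_mat PauliZ)
      + \<delta> \<cdot>\<^sub>m (conj_on_qubit n H j (pauli_mat PauliX) * conj_on_qubit n H j (pauli_mat PauliZ))"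
    if "H \<in> unitaries (2 ^ n)" "j \<in> {1..n}" for H j
    unfolding A using c[of PauliX] c[of PauliZ]
    by (simp add: conj_on_qubit_add[OF that] conj_on_qubit_smult[OF that] conj_on_qubit_mult[OF that]
        conj_on_qubit_one[OF that] del: pauli_mat.simps)
  then show ?thesis using G k X Z by simp
qed

section \<open>Products of Clifford gates\<close>

lemma pauli_string_carrier:
  "length Qs = n \<Longrightarrow> pauli_string Qs \<in> carrier_mat (2 ^ n) (2 ^ n)"
  by (intro carrier_matI) auto

lemma clifford_one: "clifford n (1\<^sub>m (2 ^ n))"
proof -
  have "1\<^sub>m (2 ^ n) * pauli_string Qs * mat_adjoint (1\<^sub>m (2 ^ n)) = signed_pauli 0 Qs"
    if "length Qs = n" for Qs
    using pauli_string_carrier[OF that]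
    by (auto simp: signed_pauli_def mat_adjoint_one left_mult_one_mat[of _ "2^n" "2^n"]
        right_mult_one_mat[of _ "2^n" "2^n"] intro!: eq_matI)
  then show ?thesis using one_unitaries by (auto simp: clifford_def)
qed

text \<open>Conjugation by \<open>A * B\<close> is conjugation by \<open>B\<close> followed by
  conjugation by \<open>A\<close>. The sign from the first passes through the second, so the
  exponents add in \<open>bit\<close>.\<close>

lemma clifford_mult:
  assumes "clifford n A" "clifford n B"
  shows "clifford n (A * B)"
proof -
  have u: "A \<in> unitaries (2 ^ n)" "B \<in> unitaries (2 ^ n)" using assms by (auto simp: clifford_def)
  note c = carrier_unitaries[OF u(1)] carrier_unitaries[OF u(2)]
  have "\<exists>r Rs. length Rs = n \<and> A * B * pauli_string Qs * mat_adjoint (A * B) = signed_pauli r Rs"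
    if Q: "length Qs = n" for Qs
  proof -
    obtain r Rs where R: "length Rs = n" "B * pauli_string Qs * mat_adjoint B = signed_pauli r Rs"
      using assms(2) Q by (auto simp: clifford_def)
    obtain s Ss where S: "length Ss = n" "A * pauli_string Rs * mat_adjoint A = signed_pauli s Ss"
      using assms(1) R(1) by (auto simp: clifford_def)
    have "A * B * pauli_string Qs * mat_adjoint (A * B) =
        A * (B * pauli_string Qs * mat_adjoint B) * mat_adjoint A"
      using c pauli_string_carrier[OF Q]
      by (simp add: mat_adjoint_mult[OF c] square_mult_simps[of _ "2^n"])
    also have "\<dots> = (if r = 1 then - 1 else 1) \<cdot>\<^sub>m (A * pauli_string Rs * mat_adjoint A)"
      using c pauli_string_carrier[OF R(1)] unfolding R(2) signed_pauli_def
      by (simp add: mult_smult_distrib[of _ "2^n" "2^n" _ "2^n"]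
          mult_smult_assoc_mat[of _ "2^n" "2^n" _ "2^n"])
    also have "\<dots> = signed_pauli (r + s) Ss"
      unfolding S(2) signed_pauli_def
      by (cases r; cases s) (auto intro!: eq_matI)
    finally show ?thesis using S(1) by blast
  qed
  then show ?thesis using mult_unitaries[OF u] by (simp add: clifford_def)
qed

text \<open>Used for \<open>a = m\<close> and \<open>b = Suc m\<close>, where no Clifford gate is
  left; this ends the telescoping below.\<close>

lemma gate_prod_empty: "a < b \<Longrightarrow> gate_prod n C a b = 1\<^sub>m (2 ^ n)"
  by (simp add: gate_prod_def)

lemma clifford_gate_prod:
  assumes "\<And>i. b \<le> i \<Longrightarrow> i \<le> a \<Longrightarrow> clifford n (C i)"
  shows "clifford n (gate_prod n C a b)"
proof -
  have "clifford n (foldr (*) (map C is) (1\<^sub>m (2 ^ n)))" if "\<forall>i\<in>set is. clifford n (C i)" for "is"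
    using that by (induction "is") (auto simp: clifford_one clifford_mult)
  then show ?thesis using assms by (simp add: gate_prod_def del: upt_Suc)
qed

lemma gate_prod_unitaries:
  "(\<And>i. b \<le> i \<Longrightarrow> i \<le> a \<Longrightarrow> clifford n (C i)) \<Longrightarrow> gate_prod n C a b \<in> unitaries (2 ^ n)"
  using clifford_gate_prod[of b a n C] by (simp add: clifford_def)

text \<open>Indices decrease from left to right, so \<open>C b\<close> is the last factor of the
  fold. For \<open>a = b\<close> the other factor is the empty product.\<close>

lemma gate_prod_split_last:
  assumes "b \<le> a" and cl: "\<And>i. b \<le> i \<Longrightarrow> i \<le> a \<Longrightarrow> clifford n (C i)"
  shows "gate_prod n C a b = gate_prod n C a (Suc b) * C b"
proof -
  have c: "C i \<in> carrier_mat (2 ^ n) (2 ^ n)" if "b \<le> i" "i \<le> a" for i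
    using cl[OF that] by (auto simp: clifford_def unitaries_def)
  \<comment> \<open>The start value of a right fold can be pulled out as a right factor; the carrier
    half is there to justify reassociation in the induction.\<close>
  have "foldr (*) As B = foldr (*) As (1\<^sub>m d) * B \<and> foldr (*) As (1\<^sub>m d) \<in> carrier_mat d d"
    if "set As \<subseteq> carrier_mat d d" "B \<in> carrier_mat d d"
    for As and B :: "complex mat" and d
    using that by (induction As) (auto simp: square_mult_simps[of _ d])
  note * = conjunct1[OF this]
  have "[b..<Suc a] = b # [Suc b..<Suc a]" using assms(1) by (intro upt_conv_Cons) simp
  then have "gate_prod n C a b = foldr (*) (map C (rev [Suc b..<Suc a])) (C b * 1\<^sub>m (2 ^ n))"
    by (simp add: gate_prod_def del: upt_Suc)
  also have "C b * 1\<^sub>m (2 ^ n) = C b"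
    using c[of b] assms(1) by (intro right_mult_one_mat[of _ "2 ^ n" "2 ^ n"]) simp
  also have "foldr (*) (map C (rev [Suc b..<Suc a])) (C b) = gate_prod n C a (Suc b) * C b"
    unfolding gate_prod_def using c assms(1) by (intro *) (auto simp del: upt_Suc)
  finally show ?thesis .
qed

section \<open>Symplectic representation of signed Pauli strings\<close>

lemma symplectic_vec_carrier: "length Qs = n \<Longrightarrow> symplectic_vec r Qs \<in> carrier_vec (2 * n + 1)"
  by (intro carrier_vecI) (simp add: symplectic_vec_def)

text \<open>The z and x bits together identify each Pauli matrix, and the last entry is the sign
  exponent. Equal lengths align the three blocks.\<close>

lemma symplectic_vec_inject:
  assumes "length Qs = length Rs" "symplectic_vec r Qs = symplectic_vec s Rs"
  shows "r = s \<and> Qs = Rs"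
proof -
  have "map z_bit Qs @ map x_bit Qs @ [r] = map z_bit Rs @ map x_bit Rs @ [s]"
    using assms(2) by (metis list_vec symplectic_vec_def)
  then have rs: "r = s" and bits: "map z_bit Qs = map z_bit Rs" "map x_bit Qs = map x_bit Rs"
    using assms(1) by auto
  have "P = Q" if "z_bit P = z_bit Q" "x_bit P = x_bit Q" for P Q
    using that by (cases P; cases Q) auto
  with assms(1) bits have "Qs = Rs" by (induction rule: list_induct2) auto
  with rs show ?thesis by simp
qed

text \<open>Turns equal columns into equal operators. Both operators are required to be signed Pauli
  strings, where the definite description is known to have a value.\<close>

lemma symplectic_rep_inject:
  assumes "length Qs = n" "A = signed_pauli r Qs" "length Rs = n" "B = signed_pauli s Rs"
    and "symplectic_rep n A = symplectic_rep n B"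
  shows "A = B"
  using assms symplectic_vec_inject[of Qs Rs r s] by (simp add: symplectic_rep_signed_pauli)

section \<open>Telescoping a single circuit\<close>

locale clifford_circuit =
  fixes n m :: nat and C :: "nat \<Rightarrow> complex mat" and k :: "nat \<Rightarrow> nat"
  assumes cl: "\<And>i. i \<le> m \<Longrightarrow> clifford n (C i)" and k: "\<And>i. i \<in> {1..m} \<Longrightarrow> k i \<in> {1..n}"
begin

lemma gate_prod_m_unitaries: "gate_prod n C m i \<in> unitaries (2 ^ n)"
  using cl by (intro gate_prod_unitaries)

lemma circuit_carrier:
  assumes "j \<le> m" "\<forall>i\<in>{1..m}. U i \<in> unitaries 2"
  shows "circuit n C k j U \<in> carrier_mat (2 ^ n) (2 ^ n)"
  using assms(1)
proof (induction j)
  case 0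
  show ?case using cl[of 0] by (simp add: clifford_def carrier_unitaries)
next
  case (Suc j)
  then have "C (Suc j) \<in> carrier_mat (2 ^ n) (2 ^ n)"
    "on_qubit n (k (Suc j)) (U (Suc j)) \<in> carrier_mat (2 ^ n) (2 ^ n)"
    using cl[of "Suc j"] k[of "Suc j"] assms(2)
    by (auto simp: clifford_def carrier_unitaries intro!: on_qubit_carrier)
  with Suc show ?case by (simp add: square_mult_simps[of _ "2^n"])
qed

text \<open>The telescoped quantity \<open>gate_prod n C m (Suc j) * circuit n C k j U\<close> is
  the first \<open>j\<close> layers completed by the remaining Clifford gates. At
  \<open>j = 0\<close> no variable gate is present.\<close>

lemma circuit_start: "gate_prod n C m (Suc 0) * circuit n C k 0 U = gate_prod n C m 0"
  using gate_prod_split_last[of 0 m n C] cl by simp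

text \<open>Each further layer contributes one left factor W: the product starting at
  \<open>Suc (Suc j)\<close> absorbs \<open>C (Suc j)\<close>, and the gate \<open>U (Suc j)\<close>
  then moves to its left by conjugation.\<close>

lemma circuit_step:
  assumes "j < m" "\<forall>i\<in>{1..m}. U i \<in> unitaries 2"
  shows "gate_prod n C m (Suc (Suc j)) * circuit n C k (Suc j) U =
     conj_on_qubit n (gate_prod n C m (Suc j)) (k (Suc j)) (U (Suc j)) *
     (gate_prod n C m (Suc j) * circuit n C k j U)"
proof -
  let ?G = "gate_prod n C m (Suc j)" and ?H = "gate_prod n C m (Suc (Suc j))"
  let ?U = "on_qubit n (k (Suc j)) (U (Suc j))"
  have U: "U (Suc j) \<in> carrier_mat 2 2" using assms by (simp add: carrier_unitaries)
  have kj: "k (Suc j) \<in> {1..n}" using k[of "Suc j"] assms(1) by simp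
  have c: "?G \<in> carrier_mat (2^n) (2^n)" "?H \<in> carrier_mat (2^n) (2^n)"
    "C (Suc j) \<in> carrier_mat (2^n) (2^n)" "?U \<in> carrier_mat (2^n) (2^n)"
    "circuit n C k j U \<in> carrier_mat (2^n) (2^n)"
    "conj_on_qubit n ?G (k (Suc j)) (U (Suc j)) \<in> carrier_mat (2^n) (2^n)"
    using assms cl[of "Suc j"] U kj
    by (auto simp: clifford_def carrier_unitaries gate_prod_m_unitaries conj_on_qubit_carrier
        intro!: on_qubit_carrier circuit_carrier)
  have "?H * circuit n C k (Suc j) U = ?H * C (Suc j) * ?U * circuit n C k j U"
    using c by (simp add: square_mult_simps[of _ "2^n"])
  also have "?H * C (Suc j) = ?G"
    using gate_prod_split_last[of "Suc j" m n C] cl assms(1) by simp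
  also have "?G * ?U = conj_on_qubit n ?G (k (Suc j)) (U (Suc j)) * ?G"
    using conj_on_qubit_commute[OF gate_prod_m_unitaries kj U] by simp
  finally show ?thesis using c by (simp add: square_mult_simps[of _ "2^n"])
qed

lemma circuit_end:
  assumes "\<forall>i\<in>{1..m}. U i \<in> unitaries 2"
  shows "gate_prod n C m (Suc m) * circuit n C k m U = circuit n C k m U"
  using circuit_carrier[OF order.refl assms] by (simp add: gate_prod_empty)

text \<open>Identity gates have identity conjugates, so only the factor W of gate \<open>i\<close>
  survives in the telescoped product.\<close>

lemma circuit_single_gate:
  assumes i: "i \<in> {1..m}" and A: "A \<in> unitaries 2"
  shows "circuit n C k m ((\<lambda>_. 1\<^sub>m 2)(i := A)) =
    conj_on_qubit n (gate_prod n C m i) (k i) A * gate_prod n C m 0"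
proof -
  define U where "U = (\<lambda>_. 1\<^sub>m 2)(i := A)"
  let ?W = "conj_on_qubit n (gate_prod n C m i) (k i) A"
  have U: "\<forall>i\<in>{1..m}. U i \<in> unitaries 2" using A one_unitaries by (simp add: U_def)
  have U_simps: "U i = A" "\<And>j. j \<noteq> i \<Longrightarrow> U j = 1\<^sub>m 2"
    by (simp_all add: U_def)
  have c: "gate_prod n C m 0 \<in> carrier_mat (2^n) (2^n)" "?W \<in> carrier_mat (2^n) (2^n)"
    using i A k
    by (simp_all add: carrier_unitaries[OF gate_prod_m_unitaries]
        conj_on_qubit_carrier[OF gate_prod_m_unitaries] carrier_unitaries)
  \<comment> \<open>Invariant: the factor appears as soon as layer \<open>i\<close> has been
    included; all other layers leave the product unchanged.\<close>
  have "gate_prod n C m (Suc j) * circuit n C k j U =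
      (if i \<le> j then ?W * gate_prod n C m 0 else gate_prod n C m 0)" if "j \<le> m" for j
    using that
  proof (induction j)
    case 0
    then show ?case using i circuit_start by simp
  next
    case (Suc j)
    have kj: "k (Suc j) \<in> {1..n}" using k[of "Suc j"] Suc.prems by simp
    show ?case
      using Suc c U_simps(1) circuit_step[of j U, OF _ U] conj_on_qubit_one[OF gate_prod_m_unitaries kj]
      by (cases "i = Suc j") (auto simp: le_Suc_eq U_simps(2) simp del: circuit.simps)
  qed
  from this[of m] show ?thesis using i circuit_end[OF U] by (simp add: U_def[symmetric])
qed

section \<open>Columns of the decision matrix\<close>

lemma conj_pauli_signed_pauli:
  assumes "i \<in> {1..m}"
  obtains r Qs where "length Qs = n" "conj_pauli n m C k i P = signed_pauli r Qs"
proof -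
  have "clifford n (gate_prod n C m i)" using cl by (intro clifford_gate_prod)
  \<comment> \<open>The gate padded with \<open>PauliI\<close> is a string of length
    \<open>n\<close>, as the Clifford condition demands.\<close>
  moreover have "length (replicate (k i - 1) PauliI @ [P] @ replicate (n - k i) PauliI) = n"
    using k[OF assms] by auto
  ultimately show ?thesis using that
    unfolding clifford_def conj_pauli_def on_qubit_pauli_mat by blast
qed

text \<open>Columns count from 0 but gates from 1, and the X block follows the \<open>m\<close>
  columns of the Z block.\<close>

lemma decision_matrix_cols:
  assumes "i \<in> {1..m}"
  shows "col (decision_matrix n m C k) (i - 1) = symplectic_rep n (conj_pauli n m C k i PauliZ)"
    and "col (decision_matrix n m C k) (m + i - 1) = symplectic_rep n (conj_pauli n m C k i PauliX)"
proof -
  \<comment> \<open>Reading a column back from \<open>mat_of_cols\<close> needs its length to be the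
    number of rows.\<close>
  have "symplectic_rep n (conj_pauli n m C k i P) \<in> carrier_vec (2 * n + 1)" for P
  proof -
    obtain r Qs where "length Qs = n" "conj_pauli n m C k i P = signed_pauli r Qs"
      by (rule conj_pauli_signed_pauli[OF assms])
    then show ?thesis using symplectic_vec_carrier[of Qs n r] by (simp add: symplectic_rep_signed_pauli)
  qed
  moreover have "m + i - 1 = m + (i - 1)" "\<not> m + (i - 1) < m" "i - 1 < m" "Suc (i - 1) = i"
    using assms by auto
  ultimately show "col (decision_matrix n m C k) (i - 1) = symplectic_rep n (conj_pauli n m C k i PauliZ)"
    "col (decision_matrix n m C k) (m + i - 1) = symplectic_rep n (conj_pauli n m C k i PauliX)"
    by (simp_all add: decision_matrix_def nth_append del: upt_Suc)
qed

end

text \<open>Replaces the binary condition by one on operators: the representation is injective on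
  signed Pauli strings, and all columns come from conjugated X and Z gates.\<close>

lemma decision_matrix_eq_iff:
  assumes "clifford_circuit n m C k" "clifford_circuit n m C' l"
  shows "decision_matrix n m C' l = decision_matrix n m C k \<longleftrightarrow>
    (\<forall>i\<in>{1..m}. \<forall>P\<in>{PauliX, PauliZ}. conj_pauli n m C' l i P = conj_pauli n m C k i P)"
proof
  interpret F: clifford_circuit n m C k by fact
  interpret F': clifford_circuit n m C' l by fact
  assume eq: "decision_matrix n m C' l = decision_matrix n m C k"
  have rep_eq: "symplectic_rep n (conj_pauli n m C' l i P) = symplectic_rep n (conj_pauli n m C k i P)"
    if "i \<in> {1..m}" "P \<in> {PauliX, PauliZ}" for i P
  proof -
    from that(2) consider "P = PauliX" | "P = PauliZ" by blast
    then show ?thesis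
      by cases (simp_all only: F.decision_matrix_cols[OF that(1), symmetric]
          F'.decision_matrix_cols[OF that(1), symmetric] eq)
  qed
  show "\<forall>i\<in>{1..m}. \<forall>P\<in>{PauliX, PauliZ}. conj_pauli n m C' l i P = conj_pauli n m C k i P"
  proof (intro ballI)
    fix i P assume iP: "i \<in> {1..m}" "P \<in> {PauliX, PauliZ}"
    obtain r Qs where Q: "length Qs = n" "conj_pauli n m C' l i P = signed_pauli r Qs"
      by (rule F'.conj_pauli_signed_pauli[OF iP(1)])
    obtain s Rs where R: "length Rs = n" "conj_pauli n m C k i P = signed_pauli s Rs"
      by (rule F.conj_pauli_signed_pauli[OF iP(1)])
    show "conj_pauli n m C' l i P = conj_pauli n m C k i P"
      by (rule symplectic_rep_inject[OF Q R rep_eq[OF iP]])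
  qed
next
  assume eq: "\<forall>i\<in>{1..m}. \<forall>P\<in>{PauliX, PauliZ}. conj_pauli n m C' l i P = conj_pauli n m C k i P"
  have map_eq: "map (\<lambda>i. symplectic_rep n (conj_pauli n m C' l i P)) [1..<Suc m] =
      map (\<lambda>i. symplectic_rep n (conj_pauli n m C k i P)) [1..<Suc m]"
    if "P \<in> {PauliX, PauliZ}" for P
    using eq that by (intro map_cong refl) (auto simp del: upt_Suc)
  have "PauliX \<in> {PauliX, PauliZ}" "PauliZ \<in> {PauliX, PauliZ}" by simp_all
  from this[THEN map_eq] show "decision_matrix n m C' l = decision_matrix n m C k"
    by (simp only: decision_matrix_def)
qed

section \<open>Equivalence of two circuits\<close>

theorem theorem1:
  fixes n m :: nat
    and C C' :: "nat \<Rightarrow> complex mat"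
    and k l :: "nat \<Rightarrow> nat"
  assumes "n \<ge> 1" and "m \<ge> 1"
    and "\<And>i. i \<le> m \<Longrightarrow> clifford n (C i)"
    and "\<And>i. i \<le> m \<Longrightarrow> clifford n (C' i)"
    and "\<And>i. i \<in> {1..m} \<Longrightarrow> k i \<in> {1..n}"
    and "\<And>i. i \<in> {1..m} \<Longrightarrow> l i \<in> {1..n}"
  shows "(\<exists>\<phi>::real. \<forall>U. (\<forall>i\<in>{1..m}. U i \<in> unitaries 2) \<longrightarrow>
             circuit n C' l m U = exp (\<i> * complex_of_real \<phi>) \<cdot>\<^sub>m circuit n C k m U)
     \<longleftrightarrow>
         decision_matrix n m C' l = decision_matrix n m C k \<and>
         (\<exists>\<phi>::real. gate_prod n C' m 0 = exp (\<i> * complex_of_real \<phi>) \<cdot>\<^sub>m gate_prod n C m 0)"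
proof -
  let ?G = "gate_prod n C m" and ?G' = "gate_prod n C' m"
  let ?W = "\<lambda>i. conj_on_qubit n (?G i) (k i)" and ?W' = "\<lambda>i. conj_on_qubit n (?G' i) (l i)"
  let ?e = "\<lambda>\<phi>. exp (\<i> * complex_of_real \<phi>)"
  interpret F: clifford_circuit n m C k using assms(3,5) by unfold_locales
  interpret F': clifford_circuit n m C' l using assms(4,6) by unfold_locales
  have G: "?G i \<in> unitaries (2 ^ n)" "?G' i \<in> unitaries (2 ^ n)" for i
    using F.gate_prod_m_unitaries F'.gate_prod_m_unitaries by auto
  have W: "?W i A \<in> carrier_mat (2^n) (2^n)" "?W' i A \<in> carrier_mat (2^n) (2^n)"
    if "i \<in> {1..m}" "A \<in> carrier_mat 2 2" for i A
    using conj_on_qubit_carrier[OF G(1) assms(5)[OF that(1)] that(2)]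
      conj_on_qubit_carrier[OF G(2) assms(6)[OF that(1)] that(2)] by auto
  note dec = decision_matrix_eq_iff[OF F.clifford_circuit_axioms F'.clifford_circuit_axioms,
      unfolded conj_pauli_eq_conj_on_qubit]
  show ?thesis
  proof
    assume "\<exists>\<phi>::real. \<forall>U. (\<forall>i\<in>{1..m}. U i \<in> unitaries 2) \<longrightarrow>
             circuit n C' l m U = ?e \<phi> \<cdot>\<^sub>m circuit n C k m U"
    then obtain \<phi> where eq: "\<And>U. (\<forall>i\<in>{1..m}. U i \<in> unitaries 2) \<Longrightarrow>
        circuit n C' l m U = ?e \<phi> \<cdot>\<^sub>m circuit n C k m U" by blast
    \<comment> \<open>Only assignments with at most one non-identity gate are needed;
      \<open>\<phi>\<close> is the same for all of them.\<close>
    have single: "?W' i A * ?G' 0 = ?e \<phi> \<cdot>\<^sub>m (?W i A * ?G 0)"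
      if "i \<in> {1..m}" "A \<in> unitaries 2" for i A
    proof -
      have "\<forall>j\<in>{1..m}. ((\<lambda>_. 1\<^sub>m 2)(i := A)) j \<in> unitaries 2"
        using that one_unitaries by simp
      from eq[OF this] show ?thesis
        unfolding F.circuit_single_gate[OF that] F'.circuit_single_gate[OF that] .
    qed
    \<comment> \<open>The all-identity assignment, obtained from gate 1, which exists because
      \<open>m \<ge> 1\<close>.\<close>
    have prod: "?G' 0 = ?e \<phi> \<cdot>\<^sub>m ?G 0"
      using single[OF _ one_unitaries, of 1] assms(2) G[of 0, THEN carrier_unitaries]
        conj_on_qubit_one[OF G(1) assms(5)] conj_on_qubit_one[OF G(2) assms(6)]
      by simp
    have "?W' i (pauli_mat P) = ?W i (pauli_mat P)" if i: "i \<in> {1..m}" for i P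
    proof -
      let ?A = "pauli_mat P"
      have c: "?W i ?A \<in> carrier_mat (2^n) (2^n)" "?W' i ?A \<in> carrier_mat (2^n) (2^n)"
        using W[OF i] pauli_mat_unitaries carrier_unitaries by blast+
      \<comment> \<open>The phase in \<open>single\<close> is the one in \<open>prod\<close>, so it
        is absorbed into \<open>?G' 0\<close>. Multiplying by the adjoint of this unitary then
        leaves an equality of conjugates without any phase.\<close>
      have "?W' i ?A * ?G' 0 = ?W i ?A * ?G' 0"
        using single[OF i pauli_mat_unitaries] c G[of 0, THEN carrier_unitaries]
        by (simp add: prod mult_smult_distrib[of _ "2^n" "2^n" _ "2^n"])
      then have "?W' i ?A * ?G' 0 * mat_adjoint (?G' 0) = ?W i ?A * ?G' 0 * mat_adjoint (?G' 0)"
        by simp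
      then show ?thesis using G(2)[of 0] c
        by (simp add: unitaries_def square_mult_simps[of _ "2^n"])
    qed
    then have "decision_matrix n m C' l = decision_matrix n m C k"
      by (intro iffD2[OF dec] ballI)
    with prod show "decision_matrix n m C' l = decision_matrix n m C k \<and>
        (\<exists>\<phi>. ?G' 0 = ?e \<phi> \<cdot>\<^sub>m ?G 0)"
      by (intro conjI exI)
  next
    assume R: "decision_matrix n m C' l = decision_matrix n m C k \<and> (\<exists>\<phi>. ?G' 0 = ?e \<phi> \<cdot>\<^sub>m ?G 0)"
    then obtain \<phi> where \<phi>: "?G' 0 = ?e \<phi> \<cdot>\<^sub>m ?G 0" by blast
    \<comment> \<open>Agreement at X and Z, read off the decision matrices, extends to every 2 by 2
      matrix.\<close>
    have WW: "?W' i A = ?W i A" if "i \<in> {1..m}" "A \<in> carrier_mat 2 2" for i A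
      by (rule conj_on_qubit_cong[OF G(1) G(2) assms(5)[OF that(1)] assms(6)[OF that(1)] _ _ that(2)])
        (use iffD1[OF dec conjunct1[OF R]] that(1) in simp_all)
    have "circuit n C' l m U = ?e \<phi> \<cdot>\<^sub>m circuit n C k m U" if U: "\<forall>i\<in>{1..m}. U i \<in> unitaries 2" for U
    proof -
      \<comment> \<open>Both telescoped products start from the full Clifford products, which differ
        by the phase, and then acquire identical left factors.\<close>
      have "?G' (Suc j) * circuit n C' l j U = ?e \<phi> \<cdot>\<^sub>m (?G (Suc j) * circuit n C k j U)"
        if "j \<le> m" for j
        using that
      proof (induction j)
        case 0
        show ?case by (simp only: F.circuit_start F'.circuit_start \<phi>)
      next
        case (Suc j)
        have j: "j < m" "Suc j \<in> {1..m}" "U (Suc j) \<in> carrier_mat 2 2"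
          using Suc.prems U by (auto intro: carrier_unitaries)
        have "?G (Suc j) * circuit n C k j U \<in> carrier_mat (2^n) (2^n)"
          using j(1) carrier_unitaries[OF G(1)] F.circuit_carrier[OF _ U]
          by (intro mult_carrier_mat[of _ _ "2^n"]) simp_all
        then show ?case
          using Suc j W(1)[OF j(2,3)]
          by (simp add: F.circuit_step[OF j(1) U] F'.circuit_step[OF j(1) U] WW
              mult_smult_distrib[of _ "2^n" "2^n" _ "2^n"] del: circuit.simps)
      qed
      from this[of m] show ?thesis by (simp add: F.circuit_end[OF U] F'.circuit_end[OF U])
    qed
    then show "\<exists>\<phi>. \<forall>U. (\<forall>i\<in>{1..m}. U i \<in> unitaries 2) \<longrightarrow>
        circuit n C' l m U = ?e \<phi> \<cdot>\<^sub>m circuit n C k m U" by blast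
  qed
qed

end
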